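(* Let $\lambda\in[0,1)$, $\delta>0$, and let $(\alpha,S)$ be a phase-type job size distribution with mean $1$. Let $E[Q]$ be the mean (actual) queue length of the queue at the cavity of the push policy. Then $$\lfloor\tilde m\rfloor-\lambda_{\lfloor\tilde m\rfloor}/\delta\;\le\;E[Q]\;\le\;\lceil\tilde m\rceil-\lambda_{\lceil\tilde m\rceil}/\delta ,$$ where, with $y=\alpha(\delta I-S)^{-1}s^*$, $$\tilde m=\frac{\log\left(\frac1y+\left(\frac{\lambda}{\delta(1-\lambda)}-1\right)\frac{1-y}{y}\right)}{\log(1/y)},\qquad \lambda_m=\frac{\delta y(1-y^m)}{\delta y(1-y^m)+y^m(1-y)}\quad(m=0,1,2,\dots).$$
   Context: Job sizes: $Z$ has a phase-type (PH) distribution $(\alpha,S)$, where $\alpha$ is a probability row vector of length $n_s$, $S$ is an invertible $n_s\times n_s$ subgenerator matrix, $s^*=-S\mathbf 1$ ($\mathbf 1$ the all-ones column), $P[Z>t]=\alpha e^{St}\mathbf 1$, and $E[Z]=\alpha(-S)^{-1}\mathbf 1=1$. Push policy chain: for an integer $m\ge 0$ and a real $\nu\ge 0$, consider the continuous-time Markov chain on the states $(0,e)$ and $(q,e,j)$ with $e\in\{m,m+1\}$, $1\le q\le e$, $1\le j\le n_s$ ($q$ = actual queue length, $e$ = estimated queue length, $j$ = service phase), with the following transitions. (i) Phase changes: $(q,e,j)\to(q,e,j')$ at rate $S_{jj'}$ for $j\ne j'$. (ii) Service completions: $(q,e,j)\to(q-1,e,j')$ at rate $s^*_j\alpha_{j'}$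 if $q\ge2$; $(1,e,j)\to(0,e)$ at rate $s^*_j$. (iii) Probes: $(q,e,j)\to(\max(q,m),\max(q,m),j)$ at rate $\delta$; $(0,e)\to(m,m,j')$ at rate $\delta\alpha_{j'}$ if $m\ge1$ (if $m=0$: $(0,e)\to(0,0)$ at rate $\delta$). (iv) Job assignments: $(q,m,j)\to(q+1,m+1,j)$ at rate $\nu$ for $q\ge1$; $(0,m)\to(1,m+1,j')$ at rate $\nu\alpha_{j'}$. Let $\pi_q(m,\nu)$ be the stationary probability that the actual queue length is $q$. Queue at the cavity: the stationary chain for the unique pair $(m,\nu)$, $m\in\{0,1,2,\dots\}$, $\nu\in[0,\infty)$, with $\pi_0(m,\nu)=1-\lambda$ (this pair has $m=\lfloor\tilde m\rfloor$). Its mean queue length is $E[Q]=\sum_q q\,\pi_q(m,\nu)$. *)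

theory Defs
  imports "HOL-Analysis.Analysis"
begin

section \<open>Phase-type distributions\<close>

text \<open>
  A phase-type distribution with phases indexed by the finite type \<open>'n\<close> is given by its
  representation \<open>(\<alpha>, S)\<close>. The initial vector \<open>\<alpha>\<close> is a row vector in the mathematics,
  so a product \<open>\<alpha> M v\<close> becomes the inner product \<open>\<alpha> \<bullet> (M *v v)\<close>.
\<close>

definition prob_vector :: "real ^ 'n \<Rightarrow> bool" where
  "prob_vector \<alpha> \<longleftrightarrow> (\<forall>i. 0 \<le> \<alpha> $ i) \<and> (\<Sum>i\<in>UNIV. \<alpha> $ i) = 1"

definition subgenerator :: "real ^ 'n ^ 'n \<Rightarrow> bool" where
  "subgenerator S \<longleftrightarrow> (\<forall>i j. i \<noteq> j \<longrightarrow> 0 \<le> S $ i $ j) \<and> (\<forall>i. (\<Sum>j\<in>UNIV. S $ i $ j) \<le> 0)"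

definition phase_type :: "real ^ 'n \<Rightarrow> real ^ 'n ^ 'n \<Rightarrow> bool" where
  "phase_type \<alpha> S \<longleftrightarrow> prob_vector \<alpha> \<and> subgenerator S \<and> invertible S"

definition exit_rates :: "real ^ 'n ^ 'n \<Rightarrow> real ^ 'n" where
  "exit_rates S = - (S *v 1)"

definition ph_mean :: "real ^ 'n \<Rightarrow> real ^ 'n ^ 'n \<Rightarrow> real" where
  "ph_mean \<alpha> S = \<alpha> \<bullet> (matrix_inv (- S) *v 1)"

text \<open>The Laplace transform of the job size at \<open>\<delta>\<close> (the number \<open>y\<close> below).\<close>

definition ph_laplace :: "real ^ 'n \<Rightarrow> real ^ 'n ^ 'n \<Rightarrow> real \<Rightarrow> real" where
  "ph_laplace \<alpha> S \<delta> = \<alpha> \<bullet> (matrix_inv (mat \<delta> - S) *v exit_rates S)"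


section \<open>Stationary distributions of finite continuous-time Markov chains\<close>

text \<open>
  The chain on \<open>X\<close> jumps from \<open>x\<close> to \<open>y\<close> at rate \<open>r x y\<close>. The global balance equations are the
  equations \<open>\<pi> Q = 0\<close> for the generator \<open>Q\<close> with off-diagonal part \<open>r\<close>; a rate \<open>r x x\<close> (a
  transition that leaves the state unchanged) contributes equally to both sides and cancels.
\<close>

definition stationary_distribution :: "'s set \<Rightarrow> ('s \<Rightarrow> 's \<Rightarrow> real) \<Rightarrow> ('s \<Rightarrow> real) \<Rightarrow> bool" where
  "stationary_distribution X r \<pi> \<longleftrightarrow>
     (\<forall>x\<in>X. 0 \<le> \<pi> x) \<and> (\<Sum>x\<in>X. \<pi> x) = 1 \<and>
     (\<forall>y\<in>X. (\<Sum>x\<in>X. \<pi> x * r x y) = \<pi> y * (\<Sum>x\<in>X. r y x))"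


section \<open>The push policy chain\<close>

text \<open>
  \<open>Idle e\<close> is the state \<open>(0, e)\<close> and \<open>Busy q e j\<close> the state \<open>(q, e, j)\<close>, with actual queue
  length \<open>q\<close>, estimated queue length \<open>e\<close> and service phase \<open>j\<close>.
\<close>

datatype 'n push_state = Idle nat | Busy nat nat 'n

definition push_states :: "nat \<Rightarrow> 'n push_state set" where
  "push_states m =
     {Idle e | e. e \<in> {m, m + 1}} \<union>
     {Busy q e j | q e j. e \<in> {m, m + 1} \<and> 1 \<le> q \<and> q \<le> e}"

fun phase_rate :: "real ^ 'n ^ 'n \<Rightarrow> 'n push_state \<Rightarrow> 'n push_state \<Rightarrow> real" where
  "phase_rate S (Busy q e j) (Busy q' e' j') =
     (if q' = q \<and> e' = e \<and> j \<noteq> j' then S $ j $ j' else 0)"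
| "phase_rate S _ _ = 0"

fun service_rate :: "real ^ 'n \<Rightarrow> real ^ 'n ^ 'n \<Rightarrow> 'n push_state \<Rightarrow> 'n push_state \<Rightarrow> real" where
  "service_rate \<alpha> S (Busy q e j) (Busy q' e' j') =
     (if 2 \<le> q \<and> q' = q - 1 \<and> e' = e then exit_rates S $ j * \<alpha> $ j' else 0)"
| "service_rate \<alpha> S (Busy q e j) (Idle e') =
     (if q = 1 \<and> e' = e then exit_rates S $ j else 0)"
| "service_rate \<alpha> S _ _ = 0"

fun probe_rate :: "real ^ 'n \<Rightarrow> real \<Rightarrow> nat \<Rightarrow> 'n push_state \<Rightarrow> 'n push_state \<Rightarrow> real" where
  "probe_rate \<alpha> \<delta> m (Busy q e j) (Busy q' e' j') =
     (if q' = max q m \<and> e' = max q m \<and> j' = j then \<delta> else 0)"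
| "probe_rate \<alpha> \<delta> m (Idle e) (Busy q' e' j') =
     (if 1 \<le> m \<and> q' = m \<and> e' = m then \<delta> * \<alpha> $ j' else 0)"
| "probe_rate \<alpha> \<delta> m (Idle e) (Idle e') =
     (if m = 0 \<and> e' = 0 then \<delta> else 0)"
| "probe_rate \<alpha> \<delta> m (Busy q e j) (Idle e') = 0"

fun assign_rate :: "real ^ 'n \<Rightarrow> nat \<Rightarrow> real \<Rightarrow> 'n push_state \<Rightarrow> 'n push_state \<Rightarrow> real" where
  "assign_rate \<alpha> m \<nu> (Busy q e j) (Busy q' e' j') =
     (if e = m \<and> q' = q + 1 \<and> e' = m + 1 \<and> j' = j then \<nu> else 0)"
| "assign_rate \<alpha> m \<nu> (Idle e) (Busy q' e' j') =
     (if e = m \<and> q' = 1 \<and> e' = m + 1 then \<nu> * \<alpha> $ j' else 0)"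
| "assign_rate \<alpha> m \<nu> _ (Idle e') = 0"

definition push_rate ::
  "real ^ 'n \<Rightarrow> real ^ 'n ^ 'n \<Rightarrow> real \<Rightarrow> nat \<Rightarrow> real \<Rightarrow> 'n push_state \<Rightarrow> 'n push_state \<Rightarrow> real" where
  "push_rate \<alpha> S \<delta> m \<nu> x y =
     phase_rate S x y + service_rate \<alpha> S x y + probe_rate \<alpha> \<delta> m x y + assign_rate \<alpha> m \<nu> x y"

definition push_stationary ::
  "real ^ 'n \<Rightarrow> real ^ 'n ^ 'n \<Rightarrow> real \<Rightarrow> nat \<Rightarrow> real \<Rightarrow> ('n push_state \<Rightarrow> real) \<Rightarrow> bool" where
  "push_stationary \<alpha> S \<delta> m \<nu> \<pi> \<longleftrightarrow>
     stationary_distribution (push_states m) (push_rate \<alpha> S \<delta> m \<nu>) \<pi>"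

fun queue_length :: "'n push_state \<Rightarrow> nat" where
  "queue_length (Idle e) = 0"
| "queue_length (Busy q e j) = q"

definition queue_length_prob :: "nat \<Rightarrow> ('n push_state \<Rightarrow> real) \<Rightarrow> nat \<Rightarrow> real" where
  "queue_length_prob m \<pi> q = (\<Sum>x | x \<in> push_states m \<and> queue_length x = q. \<pi> x)"

definition mean_queue_length :: "nat \<Rightarrow> ('n push_state \<Rightarrow> real) \<Rightarrow> real" where
  "mean_queue_length m \<pi> = (\<Sum>q\<le>m + 1. real q * queue_length_prob m \<pi> q)"

text \<open>
  The queue at the cavity at load \<open>\<lambda>\<close>: the parameters \<open>(m, \<nu>)\<close> are those for which the stationary
  probability of an empty queue is \<open>1 - \<lambda>\<close>.
\<close>

definition cavity_queue ::
  "real ^ 'n \<Rightarrow> real ^ 'n ^ 'n \<Rightarrow> real \<Rightarrow> real \<Rightarrow> nat \<Rightarrow> real \<Rightarrow> ('n push_state \<Rightarrow> real) \<Rightarrow> bool" where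
  "cavity_queue \<alpha> S \<delta> lam m \<nu> \<pi> \<longleftrightarrow>
     0 \<le> \<nu> \<and> push_stationary \<alpha> S \<delta> m \<nu> \<pi> \<and> queue_length_prob m \<pi> 0 = 1 - lam"


section \<open>The quantities in the bounds\<close>

text \<open>
  For \<open>0 \<le> \<lambda> < 1\<close>, \<open>\<delta> > 0\<close> and \<open>0 < y < 1\<close> the argument of the outer logarithm is
  \<open>1 + \<lambda> (1 - y) / (\<delta> (1 - \<lambda>) y) \<ge> 1\<close>, so \<open>m_tilde\<close> is nonnegative and its floor and ceiling
  can be used as natural-number indices.
\<close>

definition m_tilde :: "real \<Rightarrow> real \<Rightarrow> real \<Rightarrow> real" where
  "m_tilde \<delta> lam y =
     ln (1 / y + (lam / (\<delta> * (1 - lam)) - 1) * ((1 - y) / y)) / ln (1 / y)"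

definition lambda_at :: "real \<Rightarrow> real \<Rightarrow> nat \<Rightarrow> real" where
  "lambda_at \<delta> y m = \<delta> * y * (1 - y ^ m) / (\<delta> * y * (1 - y ^ m) + y ^ m * (1 - y))"

end

theory Submission
  imports Defs
begin

text \<open>
  Every test function \<open>f\<close> gives a linear relation \<open>E[L f] = 0\<close> between stationary expectations, where
  \<open>L\<close> is the generator. The difference of estimated and actual queue length gives
  \<open>E[Q] = m + p - \<lambda>/\<delta>\<close>, where \<open>p\<close> is the probability that the estimate is \<open>m + 1\<close>. Hence it suffices to
  bound \<open>\<lambda> - \<lambda>\<^sub>m\<close> by \<open>\<delta> p\<close> and \<open>\<lambda>\<^sub>m\<^sub>+\<^sub>1 - \<lambda>\<close> by \<open>\<delta> (1 - p)\<close>. To this end let \<open>g\<close> be the probability that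
  a queue without probes and assignments empties within an exponential time of rate \<open>\<delta>\<close>, which is
  \<open>y\<close> to the power \<open>q - 1\<close> times the Laplace transform of the residual service time. The test
  functions \<open>g\<close> and \<open>g\<close> restricted to estimate \<open>m\<close> express both differences as sums of nonnegative
  terms, and \<open>g \<le> 1\<close> together with \<open>1 - y \<le> \<delta>\<close> (the mean job size is 1) gives the bounds. The signs
  of the same two differences show that \<open>m\<close> is the integer part of \<open>m_tilde\<close>.
\<close>

section \<open>Phase-type distributions\<close>

lemma matrix_mult_one_nth: "(S *v 1) $ i = (\<Sum>j\<in>UNIV. (S :: real ^ 'n ^ 'n) $ i $ j)"
  by (simp add: matrix_vector_mult_def)

lemma exit_rates_nth: "exit_rates S $ i = - (\<Sum>j\<in>UNIV. (S :: real ^ 'n ^ 'n) $ i $ j)"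
  by (simp add: exit_rates_def matrix_mult_one_nth)

lemma exit_rates_nonneg: "subgenerator S \<Longrightarrow> 0 \<le> exit_rates S $ i"
  by (simp add: exit_rates_nth subgenerator_def)

lemma resolvent_nth:
  "((mat \<kappa> - S) *v f) $ i = \<kappa> * f $ i - ((S :: real ^ 'n ^ 'n) *v f) $ i"
proof -
  have "mat \<kappa> *v f = \<kappa> *\<^sub>R f"
    by (simp add: vec_eq_iff matrix_vector_mult_def mat_def if_distrib if_distribR cong: if_cong)
  then show ?thesis
    by (simp add: matrix_vector_mult_diff_rdistrib)
qed

section \<open>Minimum principle for subgenerators\<close>

lemma ex_min_entry:
  fixes f :: "real ^ 'n"
  obtains i where "\<And>j. f $ i \<le> f $ j"
proof -
  have "Min (range (($) f)) \<in> range (($) f)"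
    by (intro Min_in) auto
  then obtain i where "Min (range (($) f)) = f $ i" by blast
  then have "\<And>j. f $ i \<le> f $ j"
    by (metis Min_le finite finite_imageI rangeI)
  then show ?thesis using that by blast
qed

text \<open>Lowering every entry of \<open>f\<close> to the minimum affects only off-diagonal terms,
  whose weights are nonnegative; the row sum is minus the exit rate.\<close>

lemma subgenerator_at_min:
  assumes "subgenerator S" "\<And>j. f $ i \<le> f $ j"
  shows "- (exit_rates S $ i * f $ i) \<le> (S *v f) $ i"
proof -
  have "(\<Sum>j\<in>UNIV. S $ i $ j * f $ i) \<le> (\<Sum>j\<in>UNIV. S $ i $ j * f $ j)"
    using assms by (intro sum_mono) (metis mult_left_mono order_refl subgenerator_def)
  then show ?thesis
    by (simp add: exit_rates_nth matrix_vector_mult_def sum_distrib_right)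
qed

text \<open>At a negative minimal entry \<open>k\<close>, \<open>S *v f\<close> would be nonnegative
  and \<open>\<kappa> * f $ k\<close> negative, so the resolvent image would be negative
  there.\<close>

lemma resolvent_nonneg:
  assumes "subgenerator S" "0 < \<kappa>" "\<And>i. 0 \<le> ((mat \<kappa> - S) *v f) $ i"
  shows "0 \<le> f $ i"
proof -
  obtain k where k: "\<And>j. f $ k \<le> f $ j" using ex_min_entry by blast
  have "0 \<le> f $ k"
  proof (rule ccontr)
    assume neg: "\<not> 0 \<le> f $ k"
    have "0 \<le> \<kappa> * f $ k - (S *v f) $ k"
      using assms(3)[of k] by (simp add: resolvent_nth)
    also have "\<dots> \<le> \<kappa> * f $ k + exit_rates S $ k * f $ k"
      using subgenerator_at_min[OF assms(1) k] by simp
    also have "\<dots> < 0"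
      using neg assms(2) exit_rates_nonneg[OF assms(1), of k]
      by (smt (verit) mult_pos_neg mult_nonneg_nonpos)
    finally show False by simp
  qed
  then show ?thesis using k order_trans by blast
qed

text \<open>The kernel is trivial: \<open>resolvent_nonneg\<close> applies to a kernel vector and to
  its negative.\<close>

lemma invertible_resolvent:
  assumes "subgenerator (S :: real ^ 'n ^ 'n)" "0 < \<kappa>"
  shows "invertible (mat \<kappa> - S)"
proof -
  have "f = 0" if "(mat \<kappa> - S) *v f = 0" for f
  proof -
    have "0 \<le> f $ i" for i
      using resolvent_nonneg[OF assms, of f i] that by simp
    moreover have "0 \<le> (- f) $ i" for i
    proof (rule resolvent_nonneg[OF assms])
      show "0 \<le> ((mat \<kappa> - S) *v (- f)) $ i" for i
        using that by (metis matrix_vector_mult_diff_distrib diff_0 diff_self matrix_vector_mult_0_right order_refl zero_index)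
    qed
    ultimately show "f = 0"
      by (simp add: vec_eq_iff order_antisym)
  qed
  then show ?thesis
    by (metis invertible_left_inverse matrix_left_invertible_ker)
qed

lemma matrix_inv_right_vec: "invertible A \<Longrightarrow> A *v (matrix_inv A *v x) = (x :: real ^ 'n)"
proof -
  assume "invertible A"
  then have "A ** matrix_inv A = mat 1"
    unfolding invertible_def matrix_inv_def by (metis (mono_tags, lifting) someI_ex)
  then show ?thesis by (simp add: matrix_vector_mul_assoc)
qed

text \<open>Entry \<open>i\<close> is the Laplace transform at \<open>\<kappa>\<close> of the
  remaining service time from phase \<open>i\<close>.\<close>

definition residual_laplace :: "real ^ 'n ^ 'n \<Rightarrow> real \<Rightarrow> real ^ 'n" where
  "residual_laplace S \<kappa> = matrix_inv (mat \<kappa> - S) *v exit_rates S"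

lemma ph_laplace_eq: "ph_laplace \<alpha> S \<kappa> = \<alpha> \<bullet> residual_laplace S \<kappa>"
  by (simp add: ph_laplace_def residual_laplace_def)

lemma residual_laplace_eq:
  assumes "subgenerator S" "0 < \<kappa>"
  shows "(S *v residual_laplace S \<kappa>) $ i = \<kappa> * residual_laplace S \<kappa> $ i - exit_rates S $ i"
  using matrix_inv_right_vec[OF invertible_resolvent[OF assms], of "exit_rates S"]
    resolvent_nth[of \<kappa> S "residual_laplace S \<kappa>" i]
  by (simp add: residual_laplace_def)

text \<open>The complement \<open>w\<close> has the constant \<open>\<kappa>\<close> as its
  resolvent image, which forces its minimal entry to be strictly positive.\<close>

lemma residual_laplace_less_1:
  assumes "subgenerator S" "0 < \<kappa>"
  shows "residual_laplace S \<kappa> $ i < 1"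
proof -
  define w where "w = 1 - residual_laplace S \<kappa>"
  have Sw: "(S *v w) $ i = \<kappa> * w $ i - \<kappa>" for i
    using residual_laplace_eq[OF assms, of i]
    by (simp add: w_def matrix_vector_mult_diff_distrib exit_rates_def algebra_simps)
  obtain k where k: "\<And>j. w $ k \<le> w $ j" using ex_min_entry by blast
  have "\<kappa> \<le> (\<kappa> + exit_rates S $ k) * w $ k"
    using subgenerator_at_min[OF assms(1) k] Sw[of k] by (simp add: algebra_simps)
  then have "0 < w $ k"
    using assms(2) exit_rates_nonneg[OF assms(1), of k]
    by (smt (verit) mult_nonneg_nonpos)
  then show ?thesis
    using k[of i] by (simp add: w_def)
qed

text \<open>Nonnegativity is the minimum principle. Strictness needs \<open>S\<close> invertible:
  phases of value 0 neither exit nor lead to phases of positive value, so service would never end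
  from there.\<close>

lemma residual_laplace_pos:
  assumes S: "subgenerator S" "invertible S" and \<kappa>: "0 < \<kappa>"
  shows "0 < residual_laplace S \<kappa> $ i"
proof -
  define u where "u = residual_laplace S \<kappa>"
  have eq: "(S *v u) $ i = \<kappa> * u $ i - exit_rates S $ i" for i
    unfolding u_def by (rule residual_laplace_eq[OF S(1) \<kappa>])
  have u0: "0 \<le> u $ i" for i
    by (rule resolvent_nonneg[OF S(1) \<kappa>])
      (simp add: resolvent_nth eq exit_rates_nonneg[OF S(1)])
  define N where "N = {i. u $ i = 0}"
  have closed: "exit_rates S $ i = 0 \<and> (\<forall>j. j \<notin> N \<longrightarrow> S $ i $ j = 0)" if "i \<in> N" for i
  proof -
    have nn: "0 \<le> S $ i $ j * u $ j" for j
      using that S(1) u0[of j] by (cases "j = i") (auto simp: N_def subgenerator_def)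
    \<comment> \<open>A sum of nonnegative terms equals a nonpositive number, so every term and the
      exit rate vanish.\<close>
    have "(\<Sum>j\<in>UNIV. S $ i $ j * u $ j) = - exit_rates S $ i"
      using eq[of i] that by (simp add: N_def matrix_vector_mult_def)
    moreover have "0 \<le> (\<Sum>j\<in>UNIV. S $ i $ j * u $ j)"
      using nn by (intro sum_nonneg) auto
    ultimately have "exit_rates S $ i = 0" "(\<Sum>j\<in>UNIV. S $ i $ j * u $ j) = 0"
      using exit_rates_nonneg[OF S(1), of i] by auto
    then show ?thesis
      using nn by (auto simp: sum_nonneg_eq_0_iff N_def)
  qed
  \<comment> \<open>A nonempty \<open>N\<close> would be a closed class, on which \<open>S t = -1\<close> fails where \<open>t\<close> is minimal.\<close>
  have "N = {}"
  proof (rule ccontr)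
    assume "N \<noteq> {}"
    define t where "t = matrix_inv S *v (- 1 :: real ^ 'a)"
    have St: "S *v t = - 1"
      using matrix_inv_right_vec[OF S(2)] by (simp add: t_def)
    have "Min ((($) t) ` N) \<in> (($) t) ` N"
      using \<open>N \<noteq> {}\<close> by (intro Min_in) auto
    then obtain i where i: "i \<in> N" "Min ((($) t) ` N) = t $ i" by auto
    then have min: "t $ i \<le> t $ j" if "j \<in> N" for j
      using that by (metis Min_le finite finite_imageI imageI)
    have "(\<Sum>j\<in>UNIV. S $ i $ j * t $ i) \<le> (\<Sum>j\<in>UNIV. S $ i $ j * t $ j)"
    proof (rule sum_mono)
      fix j show "S $ i $ j * t $ i \<le> S $ i $ j * t $ j"
        using closed[OF i(1)] min[of j] S(1)
        by (cases "j \<in> N"; cases "j = i") (auto simp: subgenerator_def intro: mult_left_mono)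
    qed
    also have "\<dots> = - 1"
      using arg_cong[OF St, of "\<lambda>v. v $ i"] by (simp add: matrix_vector_mult_def)
    also have "(\<Sum>j\<in>UNIV. S $ i $ j * t $ i) = 0"
      using closed[OF i(1)] by (simp add: exit_rates_nth flip: sum_distrib_right)
    finally show False by simp
  qed
  then have "u $ i \<noteq> 0" by (auto simp: N_def)
  with u0[of i] show ?thesis by (simp add: u_def)
qed

lemma inner_prob_vector_le:
  assumes "prob_vector \<alpha>" "\<And>i. f $ i \<le> g $ i"
  shows "\<alpha> \<bullet> f \<le> \<alpha> \<bullet> g"
  using assms by (auto simp: inner_vec_def prob_vector_def intro!: sum_mono mult_left_mono)

text \<open>With finitely many phases, \<open>g - f\<close> is bounded below by a positive constant,
  so strictness survives averaging even if some weights are zero.\<close>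

lemma inner_prob_vector_less:
  assumes "prob_vector \<alpha>" "\<And>i. f $ i < g $ i"
  shows "\<alpha> \<bullet> f < \<alpha> \<bullet> g"
proof -
  obtain k where k: "\<And>j. (g - f) $ k \<le> (g - f) $ j" using ex_min_entry by blast
  have sum1: "(\<Sum>i\<in>UNIV. \<alpha> $ i) = 1"
    using assms(1) by (simp add: prob_vector_def)
  have "0 < (g - f) $ k" using assms(2)[of k] by simp
  also have "\<dots> = \<alpha> \<bullet> (\<chi> i. (g - f) $ k)"
    by (simp add: inner_vec_def sum1 flip: sum_distrib_right)
  also have "\<dots> \<le> \<alpha> \<bullet> (g - f)"
    using k by (intro inner_prob_vector_le[OF assms(1)]) simp
  finally show ?thesis by (simp add: inner_diff_right)
qed

lemma inner_prob_vector_1: "prob_vector \<alpha> \<Longrightarrow> \<alpha> \<bullet> 1 = 1"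
  by (simp add: inner_vec_def prob_vector_def)

lemma ph_laplace_pos:
  assumes "phase_type \<alpha> S" "0 < \<kappa>"
  shows "0 < ph_laplace \<alpha> S \<kappa>"
  using inner_prob_vector_less[of \<alpha> 0 "residual_laplace S \<kappa>"] residual_laplace_pos assms
  by (auto simp: phase_type_def ph_laplace_eq)

lemma ph_laplace_less_1:
  assumes "phase_type \<alpha> S" "0 < \<kappa>"
  shows "ph_laplace \<alpha> S \<kappa> < 1"
  using inner_prob_vector_less[of \<alpha> "residual_laplace S \<kappa>" 1] residual_laplace_less_1 assms
  by (auto simp: phase_type_def ph_laplace_eq inner_prob_vector_1)

text \<open>Entry \<open>i\<close> is the mean remaining service time from phase
  \<open>i\<close>.\<close>

definition phase_mean :: "real ^ 'n ^ 'n \<Rightarrow> real ^ 'n" where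
  "phase_mean S = matrix_inv (- S) *v 1"

lemma phase_mean_eq: "invertible S \<Longrightarrow> S *v phase_mean S = - 1"
proof -
  assume S: "invertible S"
  have "invertible (- S)"
    using scalar_invertible[OF _ S, of "- 1"] by simp
  then have "(- S) *v phase_mean S = 1"
    unfolding phase_mean_def by (rule matrix_inv_right_vec)
  moreover have "(- S) *v phase_mean S = - (S *v phase_mean S)"
    by (simp add: vec_eq_iff matrix_vector_mult_def sum_negf)
  ultimately show ?thesis by (metis minus_minus)
qed

text \<open>This is \<open>1 - exp (- \<delta> Z) \<le> \<delta> Z\<close> in expectation.\<close>

lemma ph_laplace_ge:
  assumes ph: "phase_type \<alpha> S" and \<kappa>: "0 < \<kappa>"
  shows "1 - ph_laplace \<alpha> S \<kappa> \<le> \<kappa> * ph_mean \<alpha> S"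
proof -
  have S: "subgenerator S" "invertible S" and \<alpha>: "prob_vector \<alpha>"
    using ph by (auto simp: phase_type_def)
  define t where "t = phase_mean S"
  have St: "(S *v t) $ i = - 1" for i
    by (simp add: t_def phase_mean_eq[OF S(2)])
  have t0: "0 \<le> t $ i" for i
  proof -
    obtain k where k: "\<And>j. t $ k \<le> t $ j" using ex_min_entry by blast
    have "1 \<le> exit_rates S $ k * t $ k"
      using subgenerator_at_min[OF S(1) k] St[of k] by simp
    then have "0 \<le> t $ k"
      using exit_rates_nonneg[OF S(1), of k] by (smt (verit) mult_nonneg_nonpos)
    then show ?thesis using k order_trans by blast
  qed
  \<comment> \<open>The resolvent sends \<open>\<kappa> *\<^sub>R t\<close> to
    \<open>\<kappa>^2 *\<^sub>R t\<close> plus the constant \<open>\<kappa>\<close>, and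
    \<open>1 - residual_laplace S \<kappa>\<close> to that same constant; the difference is
    nonnegative.\<close>
  have "0 \<le> (\<kappa> *\<^sub>R t - (1 - residual_laplace S \<kappa>)) $ i" for i
  proof (rule resolvent_nonneg[OF S(1) \<kappa>])
    show "0 \<le> ((mat \<kappa> - S) *v (\<kappa> *\<^sub>R t - (1 - residual_laplace S \<kappa>))) $ i" for i
      using t0[of i] \<kappa> residual_laplace_eq[OF S(1) \<kappa>, of i] St[of i]
      unfolding resolvent_nth
      by (simp add: matrix_vector_mult_diff_distrib matrix_vector_mult_scaleR
          exit_rates_def right_diff_distrib)
  qed
  then have "\<alpha> \<bullet> (1 - residual_laplace S \<kappa>) \<le> \<alpha> \<bullet> (\<kappa> *\<^sub>R t)"
    by (intro inner_prob_vector_le[OF \<alpha>]) simp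
  then show ?thesis
    by (simp add: ph_laplace_eq inner_diff_right inner_prob_vector_1[OF \<alpha>] ph_mean_def t_def
        phase_mean_def)
qed

section \<open>The generator of the push policy chain\<close>

lemma finite_push_states: "finite (push_states m :: 'n::finite push_state set)"
proof -
  have "push_states m \<subseteq> Idle ` {m, m + 1} \<union>
      (\<Union>q\<le>m + 1. \<Union>e\<in>{m, m + 1}. range (Busy q e :: 'n \<Rightarrow> _))"
    by (auto simp: push_states_def image_iff)
  then show ?thesis by (rule finite_subset) auto
qed

lemma Idle_in_push_states: "Idle e \<in> push_states m \<longleftrightarrow> e = m \<or> e = m + 1"
  by (auto simp: push_states_def)

lemma Busy_in_push_states:
  "Busy q e j \<in> push_states m \<longleftrightarrow> (e = m \<or> e = m + 1) \<and> 1 \<le> q \<and> q \<le> e"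
  by (auto simp: push_states_def)

text \<open>From a fixed source state, each kind of transition reaches at most one pair of queue
  length and estimate, so only the sum over target phases survives.\<close>

lemma sum_push_states_Busy:
  fixes h :: "'n::finite push_state \<Rightarrow> real"
  assumes "(e = m \<or> e = m + 1) \<and> 1 \<le> q \<and> q \<le> e"
    and "\<And>e'. h (Idle e') = 0"
    and "\<And>q' e' j. q' \<noteq> q \<or> e' \<noteq> e \<Longrightarrow> h (Busy q' e' j) = 0"
  shows "sum h (push_states m) = (\<Sum>j\<in>UNIV. h (Busy q e j))"
proof -
  have "h x = 0" if "x \<notin> range (Busy q e)" for x
    using that assms(2,3) by (cases x) (auto simp: image_iff)
  moreover have "range (Busy q e) \<subseteq> (push_states m :: 'n push_state set)"
    using assms(1) by (auto simp: Busy_in_push_states)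
  ultimately have "sum h (push_states m) = sum h (range (Busy q e))"
    by (intro sum.mono_neutral_right finite_push_states) auto
  then show ?thesis
    by (simp add: sum.reindex inj_on_def)
qed

lemma sum_push_states_Idle:
  fixes h :: "'n::finite push_state \<Rightarrow> real"
  assumes "e = m \<or> e = m + 1"
    and "\<And>e'. e' \<noteq> e \<Longrightarrow> h (Idle e') = 0" and "\<And>q' e' j. h (Busy q' e' j) = 0"
  shows "sum h (push_states m) = h (Idle e)"
proof -
  have "h x = 0" if "x \<noteq> Idle e" for x
    using that assms by (cases x) auto
  moreover have "Idle e \<in> (push_states m :: 'n push_state set)"
    using assms(1) by (auto simp: Idle_in_push_states)
  ultimately have "sum h (push_states m) = sum h {Idle e}"
    by (intro sum.mono_neutral_right finite_push_states) auto
  then show ?thesis by simp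
qed

text \<open>Weak form of stationarity: after exchanging the sums, global balance turns the inflow
  into the outflow, and the two double sums cancel.\<close>

lemma stationary_test_function:
  assumes "stationary_distribution X r \<pi>"
  shows "(\<Sum>x\<in>X. \<pi> x * (\<Sum>z\<in>X. r x z * (f z - f x))) = 0"
proof -
  have "(\<Sum>x\<in>X. \<pi> x * (\<Sum>z\<in>X. r x z * (f z - f x)))
      = (\<Sum>x\<in>X. \<Sum>z\<in>X. \<pi> x * r x z * f z) - (\<Sum>x\<in>X. \<Sum>z\<in>X. \<pi> x * r x z * f x)"
    by (simp add: sum_distrib_left algebra_simps sum_subtractf)
  also have "(\<Sum>x\<in>X. \<Sum>z\<in>X. \<pi> x * r x z * f z) = (\<Sum>z\<in>X. (\<Sum>x\<in>X. \<pi> x * r x z) * f z)"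
    by (subst sum.swap) (simp add: sum_distrib_right)
  also have "\<dots> = (\<Sum>z\<in>X. (\<pi> z * (\<Sum>x\<in>X. r z x)) * f z)"
    using assms by (intro sum.cong) (auto simp: stationary_distribution_def)
  finally show ?thesis
    by (simp add: sum_distrib_left sum_distrib_right)
qed

text \<open>The diagonal of \<open>S\<close> already accounts for leaving a phase by phase change or
  completion, so these two terms subtract no \<open>f (Busy q e j)\<close>.\<close>

fun push_generator ::
  "real ^ 'n \<Rightarrow> real ^ 'n ^ 'n \<Rightarrow> real \<Rightarrow> nat \<Rightarrow> real \<Rightarrow> ('n push_state \<Rightarrow> real) \<Rightarrow> 'n push_state \<Rightarrow> real"
where
  "push_generator \<alpha> S \<delta> m \<nu> f (Busy q e j) =
     (\<Sum>j'\<in>UNIV. S $ j $ j' * f (Busy q e j'))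
     + exit_rates S $ j *
         (if 2 \<le> q then \<Sum>j'\<in>UNIV. \<alpha> $ j' * f (Busy (q - 1) e j') else f (Idle e))
     + \<delta> * (f (Busy (max q m) (max q m) j) - f (Busy q e j))
     + (if e = m then \<nu> * (f (Busy (q + 1) (m + 1) j) - f (Busy q e j)) else 0)"
| "push_generator \<alpha> S \<delta> m \<nu> f (Idle e) =
     \<delta> * ((if 1 \<le> m then \<Sum>j\<in>UNIV. \<alpha> $ j * f (Busy m m j) else f (Idle 0)) - f (Idle e))
     + (if e = m then \<nu> * ((\<Sum>j\<in>UNIV. \<alpha> $ j * f (Busy 1 (m + 1) j)) - f (Idle e)) else 0)"

lemma push_rate_generator:
  fixes f :: "'n::finite push_state \<Rightarrow> real"
  assumes \<alpha>: "prob_vector \<alpha>" and x: "x \<in> push_states m"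
  shows "(\<Sum>z\<in>push_states m. push_rate \<alpha> S \<delta> m \<nu> x z * (f z - f x))
    = push_generator \<alpha> S \<delta> m \<nu> f x"
proof -
  let ?X = "push_states m :: 'n push_state set"
  have split: "(\<Sum>z\<in>?X. push_rate \<alpha> S \<delta> m \<nu> x z * (f z - f x))
      = (\<Sum>z\<in>?X. phase_rate S x z * (f z - f x)) + (\<Sum>z\<in>?X. service_rate \<alpha> S x z * (f z - f x))
      + (\<Sum>z\<in>?X. probe_rate \<alpha> \<delta> m x z * (f z - f x)) + (\<Sum>z\<in>?X. assign_rate \<alpha> m \<nu> x z * (f z - f x))"
    by (simp add: push_rate_def distrib_right sum.distrib)
  have avg: "(\<Sum>j\<in>UNIV. c * \<alpha> $ j * (h j - d)) = c * ((\<Sum>j\<in>UNIV. \<alpha> $ j * h j) - d)" for c d h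
    using \<alpha> by (simp add: prob_vector_def right_diff_distrib sum_subtractf mult.assoc
        flip: sum_distrib_left sum_distrib_right)
  show ?thesis
  proof (cases x)
    case (Busy q e j)
    then have qe: "e = m \<or> e = m + 1" "1 \<le> q" "q \<le> e"
      using x by (auto simp: Busy_in_push_states)
    have "(\<Sum>z\<in>?X. phase_rate S x z * (f z - f x))
        = (\<Sum>j'\<in>UNIV. phase_rate S x (Busy q e j') * (f (Busy q e j') - f x))"
      using qe Busy by (intro sum_push_states_Busy)
        auto
    \<comment> \<open>The diagonal may be included since its difference is zero. The row sum then
      produces \<open>exit_rates S $ j * f x\<close>, which cancels the loss term in
      \<open>2\<close>.\<close>
    also have "\<dots> = (\<Sum>j'\<in>UNIV. S $ j $ j' * (f (Busy q e j') - f x))"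
      using Busy by (intro sum.cong) auto
    also have "\<dots> = (\<Sum>j'\<in>UNIV. S $ j $ j' * f (Busy q e j')) + exit_rates S $ j * f x"
      by (simp add: exit_rates_nth right_diff_distrib sum_subtractf sum_distrib_right)
    finally have 1: "(\<Sum>z\<in>?X. phase_rate S x z * (f z - f x)) = \<dots>" .
    have 2: "(\<Sum>z\<in>?X. service_rate \<alpha> S x z * (f z - f x)) = exit_rates S $ j *
         ((if 2 \<le> q then \<Sum>j'\<in>UNIV. \<alpha> $ j' * f (Busy (q - 1) e j') else f (Idle e)) - f x)"
    proof (cases "2 \<le> q")
      case True
      have "(\<Sum>z\<in>?X. service_rate \<alpha> S x z * (f z - f x))
        = (\<Sum>j'\<in>UNIV. service_rate \<alpha> S x (Busy (q - 1) e j') * (f (Busy (q - 1) e j') - f x))"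
        using qe Busy True by (intro sum_push_states_Busy)
          auto
      then show ?thesis using Busy True by (simp add: avg)
    next
      case False
      then have "(\<Sum>z\<in>?X. service_rate \<alpha> S x z * (f z - f x))
          = service_rate \<alpha> S x (Idle e) * (f (Idle e) - f x)"
        using qe Busy by (intro sum_push_states_Idle)
          auto
      then show ?thesis using Busy False qe by simp
    qed
    have 3: "(\<Sum>z\<in>?X. probe_rate \<alpha> \<delta> m x z * (f z - f x))
        = \<delta> * (f (Busy (max q m) (max q m) j) - f x)"
    proof -
      have "(\<Sum>z\<in>?X. probe_rate \<alpha> \<delta> m x z * (f z - f x))
        = (\<Sum>j'\<in>UNIV. probe_rate \<alpha> \<delta> m x (Busy (max q m) (max q m) j')
            * (f (Busy (max q m) (max q m) j') - f x))"
        using qe Busy by (intro sum_push_states_Busy)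
          auto
      also have "\<dots> = (\<Sum>j'\<in>UNIV. if j' = j then \<delta> * (f (Busy (max q m) (max q m) j') - f x) else 0)"
        using Busy by (intro sum.cong) auto
      finally show ?thesis by simp
    qed
    have 4: "(\<Sum>z\<in>?X. assign_rate \<alpha> m \<nu> x z * (f z - f x))
        = (if e = m then \<nu> * (f (Busy (q + 1) (m + 1) j) - f x) else 0)"
    proof (cases "e = m")
      case True
      then have "(\<Sum>z\<in>?X. assign_rate \<alpha> m \<nu> x z * (f z - f x))
        = (\<Sum>j'\<in>UNIV. assign_rate \<alpha> m \<nu> x (Busy (q + 1) (m + 1) j')
            * (f (Busy (q + 1) (m + 1) j') - f x))"
        using qe Busy by (intro sum_push_states_Busy)
          auto
      also have "\<dots> = (\<Sum>j'\<in>UNIV. if j' = j then \<nu> * (f (Busy (q + 1) (m + 1) j') - f x) else 0)"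
        using Busy True by (intro sum.cong) auto
      finally show ?thesis using True by simp
    next
      case False
      then have "assign_rate \<alpha> m \<nu> x z = 0" for z
        using Busy by (cases z) auto
      then show ?thesis using False by simp
    qed
    show ?thesis
      unfolding split 1 2 3 4 by (simp add: Busy algebra_simps)
  next
    case (Idle e)
    then have e: "e = m \<or> e = m + 1"
      using x by (auto simp: Idle_in_push_states)
    have 1: "(\<Sum>z\<in>?X. phase_rate S x z * (f z - f x)) = 0"
      using Idle by (simp add: sum.neutral)
    have 2: "(\<Sum>z\<in>?X. service_rate \<alpha> S x z * (f z - f x)) = 0"
      using Idle by (simp add: sum.neutral)
    have 3: "(\<Sum>z\<in>?X. probe_rate \<alpha> \<delta> m x z * (f z - f x))
        = \<delta> * ((if 1 \<le> m then \<Sum>j\<in>UNIV. \<alpha> $ j * f (Busy m m j) else f (Idle 0)) - f x)"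
    proof (cases "1 \<le> m")
      case True
      then have "(\<Sum>z\<in>?X. probe_rate \<alpha> \<delta> m x z * (f z - f x))
        = (\<Sum>j'\<in>UNIV. probe_rate \<alpha> \<delta> m x (Busy m m j') * (f (Busy m m j') - f x))"
        using Idle by (intro sum_push_states_Busy)
          auto
      then show ?thesis using Idle True by (simp add: avg)
    next
      case False
      then have "(\<Sum>z\<in>?X. probe_rate \<alpha> \<delta> m x z * (f z - f x))
          = probe_rate \<alpha> \<delta> m x (Idle 0) * (f (Idle 0) - f x)"
        using Idle by (intro sum_push_states_Idle)
          auto
      then show ?thesis using Idle False by simp
    qed
    have 4: "(\<Sum>z\<in>?X. assign_rate \<alpha> m \<nu> x z * (f z - f x))
        = (if e = m then \<nu> * ((\<Sum>j\<in>UNIV. \<alpha> $ j * f (Busy 1 (m + 1) j)) - f x) else 0)"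
    proof (cases "e = m")
      case True
      then have "(\<Sum>z\<in>?X. assign_rate \<alpha> m \<nu> x z * (f z - f x))
        = (\<Sum>j'\<in>UNIV. assign_rate \<alpha> m \<nu> x (Busy 1 (m + 1) j') * (f (Busy 1 (m + 1) j') - f x))"
        using Idle by (intro sum_push_states_Busy)
          auto
      then show ?thesis using Idle True by (simp add: avg)
    next
      case False
      then have "assign_rate \<alpha> m \<nu> x z = 0" for z
        using Idle by (cases z) auto
      then show ?thesis using False by simp
    qed
    show ?thesis
      unfolding split 1 2 3 4 by (simp add: Idle)
  qed
qed

section \<open>Stationary expectations in the queue at the cavity\<close>

locale cavity =
  fixes \<alpha> :: "real ^ 'n" and S :: "real ^ 'n ^ 'n" and \<delta> lam \<nu> :: real and m :: nat
    and \<pi> :: "'n push_state \<Rightarrow> real"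
  assumes delta_pos: "0 < \<delta>" and lam_nonneg: "0 \<le> lam" and lam_less_1: "lam < 1"
    and phase_type: "phase_type \<alpha> S" and mean_1: "ph_mean \<alpha> S = 1"
    and cavity_queue: "cavity_queue \<alpha> S \<delta> lam m \<nu> \<pi>"
begin

lemma prob_vector: "prob_vector \<alpha>" and subgenerator: "subgenerator S"
  and invertible: "invertible S"
  using phase_type by (auto simp: phase_type_def)

lemma nu_nonneg: "0 \<le> \<nu>"
  and stationary: "stationary_distribution (push_states m) (push_rate \<alpha> S \<delta> m \<nu>) \<pi>"
  and idle_prob: "queue_length_prob m \<pi> 0 = 1 - lam"
  using cavity_queue by (auto simp: cavity_queue_def push_stationary_def)

lemma sum_alpha: "(\<Sum>j\<in>UNIV. \<alpha> $ j) = 1"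
  using prob_vector by (simp add: prob_vector_def)

lemma sum_alpha_times: "(\<Sum>j\<in>UNIV. \<alpha> $ j * c) = c"
  by (simp add: sum_alpha flip: sum_distrib_right)

lemma sum_S_times: "(\<Sum>j'\<in>UNIV. S $ j $ j' * c) = - exit_rates S $ j * c"
  by (simp add: exit_rates_nth flip: sum_distrib_right)

text \<open>Giving the idle and busy values separately lets indicators be written directly, and
  linear combinations merge into one expectation that is compared pointwise.\<close>

definition expect :: "(nat \<Rightarrow> real) \<Rightarrow> (nat \<Rightarrow> nat \<Rightarrow> 'n \<Rightarrow> real) \<Rightarrow> real" where
  "expect a b = (\<Sum>x\<in>push_states m. \<pi> x * (case x of Idle e \<Rightarrow> a e | Busy q e j \<Rightarrow> b q e j))"

lemma expect_cong:
  assumes "\<And>e. e = m \<or> e = m + 1 \<Longrightarrow> a e = a' e"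
    and "\<And>q e j. e = m \<or> e = m + 1 \<Longrightarrow> 1 \<le> q \<Longrightarrow> q \<le> e \<Longrightarrow> b q e j = b' q e j"
  shows "expect a b = expect a' b'"
  unfolding expect_def using assms
  by (intro sum.cong refl)
    (auto simp: Idle_in_push_states Busy_in_push_states split: push_state.split)

lemma expect_mono:
  assumes "\<And>e. e = m \<or> e = m + 1 \<Longrightarrow> a e \<le> a' e"
    and "\<And>q e j. e = m \<or> e = m + 1 \<Longrightarrow> 1 \<le> q \<Longrightarrow> q \<le> e \<Longrightarrow> b q e j \<le> b' q e j"
  shows "expect a b \<le> expect a' b'"
  unfolding expect_def using assms stationary
  by (intro sum_mono mult_left_mono)
    (auto simp: Idle_in_push_states Busy_in_push_states stationary_distribution_def
      split: push_state.split)

lemma expect_add: "expect a b + expect a' b' = expect (\<lambda>e. a e + a' e) (\<lambda>q e j. b q e j + b' q e j)"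
  unfolding expect_def sum.distrib[symmetric]
  by (intro sum.cong refl) (auto simp: distrib_left split: push_state.split)

lemma expect_mult: "c * expect a b = expect (\<lambda>e. c * a e) (\<lambda>q e j. c * b q e j)"
  unfolding expect_def sum_distrib_left
  by (intro sum.cong refl) (auto simp: split: push_state.split)

lemma expect_diff: "expect a b - expect a' b' = expect (\<lambda>e. a e - a' e) (\<lambda>q e j. b q e j - b' q e j)"
  unfolding expect_def sum_subtractf[symmetric]
  by (intro sum.cong refl) (auto simp: right_diff_distrib split: push_state.split)

lemma expect_const: "expect (\<lambda>_. c) (\<lambda>_ _ _. c) = c"
proof -
  have "expect (\<lambda>_. c) (\<lambda>_ _ _. c) = (\<Sum>x\<in>push_states m. \<pi> x * c)"
    unfolding expect_def by (intro sum.cong refl) (auto split: push_state.split)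
  then show ?thesis
    using stationary by (simp add: stationary_distribution_def flip: sum_distrib_right)
qed

lemma expect_nonneg:
  assumes "\<And>e. e = m \<or> e = m + 1 \<Longrightarrow> 0 \<le> a e"
    and "\<And>q e j. e = m \<or> e = m + 1 \<Longrightarrow> 1 \<le> q \<Longrightarrow> q \<le> e \<Longrightarrow> 0 \<le> b q e j"
  shows "0 \<le> expect a b"
  using expect_mono[of "\<lambda>_. 0" a "\<lambda>_ _ _. 0" b] assms expect_const[of 0] by simp

lemmas expect_linear = expect_add expect_diff expect_mult

text \<open>The source of all balance equations below: each comes from a test function
  \<open>f\<close> and a closed form of its generator.\<close>

lemma expect_generator:
  assumes "\<And>e. e = m \<or> e = m + 1 \<Longrightarrow> push_generator \<alpha> S \<delta> m \<nu> f (Idle e) = a e"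
    and "\<And>q e j. e = m \<or> e = m + 1 \<Longrightarrow> 1 \<le> q \<Longrightarrow> q \<le> e \<Longrightarrow>
      push_generator \<alpha> S \<delta> m \<nu> f (Busy q e j) = b q e j"
  shows "expect a b = 0"
proof -
  have "expect a b = (\<Sum>x\<in>push_states m. \<pi> x * push_generator \<alpha> S \<delta> m \<nu> f x)"
    unfolding expect_def using assms
    by (intro sum.cong refl)
      (auto simp: Idle_in_push_states Busy_in_push_states simp del: push_generator.simps
        split: push_state.split)
  also have "\<dots> = (\<Sum>x\<in>push_states m. \<pi> x *
      (\<Sum>z\<in>push_states m. push_rate \<alpha> S \<delta> m \<nu> x z * (f z - f x)))"
    by (intro sum.cong refl) (simp add: push_rate_generator[OF prob_vector])
  also have "\<dots> = 0"
    by (rule stationary_test_function[OF stationary])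
  finally show ?thesis .
qed

lemma expect_idle: "expect (\<lambda>_. 1) (\<lambda>_ _ _. 0) = 1 - lam"
proof -
  have "expect (\<lambda>_. 1) (\<lambda>_ _ _. 0)
      = (\<Sum>x\<in>push_states m. if queue_length x = 0 then \<pi> x else 0)"
    unfolding expect_def
    by (intro sum.cong refl) (auto simp: Busy_in_push_states split: push_state.split)
  also have "\<dots> = queue_length_prob m \<pi> 0"
    unfolding queue_length_prob_def by (rule sum.inter_filter[symmetric, OF finite_push_states])
  finally show ?thesis by (simp add: idle_prob)
qed

lemma expect_busy: "expect (\<lambda>_. 0) (\<lambda>_ _ _. 1) = lam"
  using expect_const[of 1] expect_add[of "\<lambda>_. 1" "\<lambda>_ _ _. 0" "\<lambda>_. 0" "\<lambda>_ _ _. 1"] expect_idle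
  by simp

lemma mean_queue_length_eq: "mean_queue_length m \<pi> = expect (\<lambda>_. 0) (\<lambda>q _ _. real q)"
proof -
  have "mean_queue_length m \<pi>
      = (\<Sum>q\<le>m + 1. \<Sum>x | x \<in> push_states m \<and> queue_length x = q. \<pi> x * real (queue_length x))"
    unfolding mean_queue_length_def queue_length_prob_def sum_distrib_left
    by (intro sum.cong refl) auto
  also have "\<dots> = (\<Sum>x\<in>push_states m. \<pi> x * real (queue_length x))"
    by (rule sum.group[OF finite_push_states]) (auto simp: push_states_def)
  also have "\<dots> = expect (\<lambda>_. 0) (\<lambda>q _ _. real q)"
    unfolding expect_def by (intro sum.cong refl) (auto split: push_state.split)
  finally show ?thesis .
qed

text \<open>
  The phase is renewed from \<open>\<alpha>\<close> at every service start, at a rate that \<open>\<phi> = phase_mean S\<close>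
  identifies as \<open>lam\<close>.
\<close>

lemma expect_phase: "expect (\<lambda>_. 0) (\<lambda>_ _ j. (S *v \<phi>) $ j) = - lam * (\<alpha> \<bullet> \<phi>)"
proof -
  \<comment> \<open>\<open>c\<close> is the rate of service starts: probes of and assignments to
    idle queues, and completions that leave a job waiting.\<close>
  define c where "c = expect (\<lambda>e. \<delta> * of_bool (1 \<le> m) + \<nu> * of_bool (e = m))
    (\<lambda>q _ j. exit_rates S $ j * of_bool (2 \<le> q))"
  have start: "expect (\<lambda>_. 0) (\<lambda>_ _ j. (S *v \<phi>) $ j) = - c * (\<alpha> \<bullet> \<phi>)" for \<phi>
  proof -
    have "expect (\<lambda>e. (\<alpha> \<bullet> \<phi>) * (\<delta> * of_bool (1 \<le> m) + \<nu> * of_bool (e = m)))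
      (\<lambda>q _ j. (S *v \<phi>) $ j + (\<alpha> \<bullet> \<phi>) * (exit_rates S $ j * of_bool (2 \<le> q))) = 0"
      by (rule expect_generator[where f = "\<lambda>x. case x of Idle _ \<Rightarrow> 0 | Busy _ _ j \<Rightarrow> \<phi> $ j"])
        (auto simp: matrix_vector_mult_def inner_vec_def algebra_simps)
    then have "expect (\<lambda>_. 0) (\<lambda>_ _ j. (S *v \<phi>) $ j) + (\<alpha> \<bullet> \<phi>) * c = 0"
      by (simp add: c_def expect_linear)
    then show ?thesis by (simp add: algebra_simps)
  qed
  have "\<alpha> \<bullet> phase_mean S = 1"
    using mean_1 by (simp add: ph_mean_def phase_mean_def)
  then have "- lam = - c"
    using start[of "phase_mean S"] expect_mult[of "- 1" "\<lambda>_. 0" "\<lambda>_ _ _. 1"]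
    by (simp add: phase_mean_eq[OF invertible] expect_busy)
  then show ?thesis using start by simp
qed

text \<open>The case \<open>\<phi> = 1\<close> of \<open>expect_phase\<close>: \<open>S *v 1\<close>
  is minus the exit rates.\<close>

lemma completion_rate: "expect (\<lambda>_. 0) (\<lambda>_ _ j. exit_rates S $ j) = lam"
  using expect_phase[of 1] expect_mult[of "- 1" "\<lambda>_. 0" "\<lambda>_ _ j. (S *v 1) $ j"]
  by (simp add: exit_rates_def inner_prob_vector_1[OF prob_vector])

text \<open>Apply \<open>expect_phase\<close> to \<open>1 - residual_laplace S \<delta>\<close>: the
  exit rates cancel, and \<open>S\<close> maps it to \<open>- \<delta>\<close> times
  \<open>residual_laplace S \<delta>\<close>.\<close>

lemma expect_residual_laplace:
  "\<delta> * expect (\<lambda>_. 0) (\<lambda>_ _ j. residual_laplace S \<delta> $ j) = lam * (1 - ph_laplace \<alpha> S \<delta>)"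
proof -
  have "(S *v (1 - residual_laplace S \<delta>)) $ j = - \<delta> * residual_laplace S \<delta> $ j" for j
    using residual_laplace_eq[OF subgenerator delta_pos, of j]
    by (simp add: matrix_vector_mult_diff_distrib exit_rates_def)
  then have "expect (\<lambda>_. 0) (\<lambda>_ _ j. - \<delta> * residual_laplace S \<delta> $ j)
      = - lam * (1 - ph_laplace \<alpha> S \<delta>)"
    using expect_phase[of "1 - residual_laplace S \<delta>"]
    by (simp add: inner_diff_right inner_prob_vector_1[OF prob_vector] ph_laplace_eq)
  then show ?thesis
    using expect_mult[of "- \<delta>" "\<lambda>_. 0" "\<lambda>_ _ j. residual_laplace S \<delta> $ j"] by simp
qed

section \<open>Mean queue length and the law of the estimate\<close>

definition prob_full :: real where
  "prob_full = expect (\<lambda>_. 0) (\<lambda>q _ _. of_bool (q = m + 1))"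

definition prob_upper :: real where
  "prob_upper = expect (\<lambda>e. of_bool (e = m + 1)) (\<lambda>_ e _. of_bool (e = m + 1))"

definition prob_idle_lower :: real where
  "prob_idle_lower = expect (\<lambda>e. of_bool (e = m)) (\<lambda>_ _ _. 0)"

text \<open>
  The gap between estimated and actual queue length grows by one at every service completion
  and is reset to zero by a probe.
\<close>

lemma mean_queue_length: "mean_queue_length m \<pi> = m + prob_upper - lam / \<delta>"
proof -
  have "expect (\<lambda>e. - \<delta> * real e) (\<lambda>q e j. exit_rates S $ j - \<delta> * (real e - real q)) = 0"
    by (rule expect_generator[where f = "\<lambda>x. case x of Idle e \<Rightarrow> real e | Busy q e _ \<Rightarrow> real e - real q"])
      (auto simp: sum_S_times sum_alpha_times, auto simp: algebra_simps)
  \<comment> \<open>Assignments raise both lengths by one, so \<open>\<nu>\<close> is absent. The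
    mean estimate is \<open>m + prob_upper\<close>.\<close>
  also have "expect (\<lambda>e. - \<delta> * real e) (\<lambda>q e j. exit_rates S $ j - \<delta> * (real e - real q))
      = expect (\<lambda>_. 0) (\<lambda>_ _ j. exit_rates S $ j)
        - \<delta> * (expect (\<lambda>_. real m) (\<lambda>_ _ _. real m) + prob_upper - mean_queue_length m \<pi>)"
    unfolding prob_upper_def mean_queue_length_eq expect_linear
    by (rule expect_cong) (auto simp: algebra_simps)
  finally show ?thesis
    using delta_pos by (simp add: completion_rate expect_const field_simps)
qed

text \<open>Flow between the two estimates: assignments lead up, probes lead down unless the queue
  really has length \<open>m + 1\<close>.\<close>

lemma estimate_balance: "\<delta> * (prob_upper - prob_full) = \<nu> * (1 - prob_upper)"
proof -
  have "expect (\<lambda>e. - \<delta> * of_bool (e = m + 1) + \<nu> * of_bool (e = m))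
    (\<lambda>q e _. \<delta> * (of_bool (q = m + 1) - of_bool (e = m + 1)) + \<nu> * of_bool (e = m)) = 0"
    by (rule expect_generator[where
          f = "\<lambda>x. case x of Idle e \<Rightarrow> of_bool (e = m + 1) | Busy _ e _ \<Rightarrow> of_bool (e = m + 1)"])
      (auto simp: sum_S_times sum_alpha_times sum_alpha max_def)
  also have "expect (\<lambda>e. - \<delta> * of_bool (e = m + 1) + \<nu> * of_bool (e = m))
    (\<lambda>q e _. \<delta> * (of_bool (q = m + 1) - of_bool (e = m + 1)) + \<nu> * of_bool (e = m))
    = \<delta> * (prob_full - prob_upper) + \<nu> * (expect (\<lambda>_. 1) (\<lambda>_ _ _. 1) - prob_upper)"
    unfolding prob_upper_def prob_full_def expect_linear
    by (rule expect_cong) auto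
  finally show ?thesis by (simp add: expect_const algebra_simps)
qed

text \<open>
  The probability that, in the absence of assignments, the queue empties within an independent
  exponential time of rate \<open>\<kappa>\<close>: the geometric factor comes from the jobs behind the one in service.
\<close>

definition drain :: "real \<Rightarrow> nat \<Rightarrow> 'n \<Rightarrow> real" where
  "drain \<kappa> q j = residual_laplace S \<kappa> $ j * ph_laplace \<alpha> S \<kappa> ^ (q - 1)"

lemma drain_start: "1 \<le> q \<Longrightarrow> (\<Sum>j\<in>UNIV. \<alpha> $ j * drain \<kappa> q j) = ph_laplace \<alpha> S \<kappa> ^ q"
  by (cases q) (simp_all add: drain_def ph_laplace_eq inner_vec_def sum_distrib_right flip: mult.assoc)

text \<open>The resolvent equation leaves a deficit of the exit rate times
  \<open>y ^ (q - 1)\<close>, where \<open>y\<close> is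
  \<open>ph_laplace \<alpha> S \<kappa>\<close>. A completion restores it, since the remaining
  \<open>q - 1\<close> jobs start afresh; an empty queue has value 1.\<close>

lemma drain_service:
  assumes "0 < \<kappa>" "1 \<le> q"
  shows "(\<Sum>j'\<in>UNIV. S $ j $ j' * drain \<kappa> q j')
    + exit_rates S $ j * (if 2 \<le> q then \<Sum>j'\<in>UNIV. \<alpha> $ j' * drain \<kappa> (q - 1) j' else 1)
    = \<kappa> * drain \<kappa> q j"
proof -
  let ?u = "residual_laplace S \<kappa>" and ?y = "ph_laplace \<alpha> S \<kappa>"
  have "(\<Sum>j'\<in>UNIV. S $ j $ j' * drain \<kappa> q j') = (S *v ?u) $ j * ?y ^ (q - 1)"
    by (simp add: drain_def matrix_vector_mult_def sum_distrib_right mult.assoc)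
  moreover have "(if 2 \<le> q then \<Sum>j'\<in>UNIV. \<alpha> $ j' * drain \<kappa> (q - 1) j' else 1) = ?y ^ (q - 1)"
    using assms(2) drain_start[of "q - 1" \<kappa>] by (cases "2 \<le> q") (auto simp: le_Suc_eq)
  ultimately show ?thesis
    by (simp add: drain_def residual_laplace_eq[OF subgenerator assms(1)] algebra_simps)
qed

lemma drain_Suc: "1 \<le> q \<Longrightarrow> drain \<kappa> (Suc q) j = ph_laplace \<alpha> S \<kappa> * drain \<kappa> q j"
  by (cases q) (simp_all add: drain_def)

lemma drain_bounds:
  assumes "0 < \<kappa>"
  shows "0 \<le> drain \<kappa> q j" "drain \<kappa> q j \<le> 1"
  using residual_laplace_pos[OF subgenerator invertible assms, of j]
    residual_laplace_less_1[OF subgenerator assms, of j]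
    ph_laplace_pos[OF phase_type assms] ph_laplace_less_1[OF phase_type assms]
  by (auto simp: drain_def intro!: mult_le_one power_le_one)

lemma laplace_bounds: "0 < ph_laplace \<alpha> S \<delta>" "ph_laplace \<alpha> S \<delta> < 1"
  by (rule ph_laplace_pos ph_laplace_less_1, rule phase_type, rule delta_pos)+

section \<open>Balance equations for the draining probability\<close>

definition drain_lower :: "real \<Rightarrow> real" where
  "drain_lower \<kappa> = expect (\<lambda>e. of_bool (e = m)) (\<lambda>q e j. of_bool (e = m) * drain \<kappa> q j)"

text \<open>The test function is \<open>drain \<delta>\<close>, with value 1 at idle states. On busy
  states the service part cancels the probe loss, and an assignment multiplies the value by
  \<open>y\<close>.\<close>

lemma drain_balance:
  fixes y defines "y \<equiv> ph_laplace \<alpha> S \<delta>"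
  shows "\<delta> * expect (\<lambda>_. 0) (\<lambda>q e j. drain \<delta> (max q m) j)
    = \<delta> * (1 - y ^ m) * (1 - lam) + \<nu> * (1 - y) * drain_lower \<delta>"
proof -
  have "expect (\<lambda>e. \<delta> * (y ^ m - 1) + of_bool (e = m) * \<nu> * (y - 1))
     (\<lambda>q e j. \<delta> * drain \<delta> (max q m) j + of_bool (e = m) * \<nu> * (y - 1) * drain \<delta> q j) = 0"
  proof (rule expect_generator[where
        f = "\<lambda>x. case x of Idle _ \<Rightarrow> 1 | Busy q _ j \<Rightarrow> drain \<delta> q j"])
    fix q e :: nat and j :: 'n assume "1 \<le> q" "q \<le> e"
    then show "push_generator \<alpha> S \<delta> m \<nu> (\<lambda>x. case x of Idle _ \<Rightarrow> 1 | Busy q _ j \<Rightarrow> drain \<delta> q j) (Busy q e j)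
      = \<delta> * drain \<delta> (max q m) j + of_bool (e = m) * \<nu> * (y - 1) * drain \<delta> q j"
      using drain_service[OF delta_pos, of q j] by (cases "2 \<le> q") (auto simp: y_def drain_Suc algebra_simps)
  qed (cases m; auto simp: drain_start y_def algebra_simps)
  also have "expect (\<lambda>e. \<delta> * (y ^ m - 1) + of_bool (e = m) * \<nu> * (y - 1))
     (\<lambda>q e j. \<delta> * drain \<delta> (max q m) j + of_bool (e = m) * \<nu> * (y - 1) * drain \<delta> q j)
    = \<delta> * expect (\<lambda>_. 0) (\<lambda>q e j. drain \<delta> (max q m) j)
      - \<delta> * (1 - y ^ m) * (1 - lam) - \<nu> * (1 - y) * drain_lower \<delta>"
    unfolding drain_lower_def expect_idle[symmetric] expect_linear
    by (rule expect_cong) (auto simp: algebra_simps)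
  finally show ?thesis by simp
qed

text \<open>The same kind of test function, set to zero at estimate \<open>m + 1\<close>:
  assignments now lose all value, and a probe gives value only if it finds \<open>q \<le> m\<close>.
  The discount \<open>\<kappa>\<close> stays free because both \<open>\<delta>\<close> and
  \<open>\<delta> + \<nu>\<close> are used.\<close>

lemma drain_lower_balance:
  fixes \<kappa> y :: real assumes \<kappa>: "0 < \<kappa>" defines "y \<equiv> ph_laplace \<alpha> S \<kappa>"
  shows "\<delta> * expect (\<lambda>_. 0) (\<lambda>q e j. of_bool (q \<le> m) * drain \<kappa> m j) + \<delta> * y ^ m * (1 - lam)
    = \<kappa> * prob_idle_lower + (\<delta> + \<nu> - \<kappa>) * drain_lower \<kappa>"
proof -
  let ?f = "\<lambda>x. case x of Idle e \<Rightarrow> of_bool (e = m) | Busy q e j \<Rightarrow> of_bool (e = m) * drain \<kappa> q j"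
  have "expect (\<lambda>e. \<delta> * y ^ m - of_bool (e = m) * (\<delta> + \<nu>))
     (\<lambda>q e j. \<delta> * of_bool (q \<le> m) * drain \<kappa> m j
        + (\<kappa> - \<delta> - \<nu>) * of_bool (e = m) * drain \<kappa> q j) = 0"
  proof (rule expect_generator[where f = ?f])
    fix q e :: nat and j :: 'n assume q: "e = m \<or> e = m + 1" "1 \<le> q" "q \<le> e"
    then show "push_generator \<alpha> S \<delta> m \<nu> ?f (Busy q e j)
      = \<delta> * of_bool (q \<le> m) * drain \<kappa> m j
        + (\<kappa> - \<delta> - \<nu>) * of_bool (e = m) * drain \<kappa> q j"
      using drain_service[OF \<kappa>, of q j] by (cases "e = m") (auto simp: max_def algebra_simps)
  qed (cases m; auto simp: drain_start y_def algebra_simps)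
  also have "expect (\<lambda>e. \<delta> * y ^ m - of_bool (e = m) * (\<delta> + \<nu>))
     (\<lambda>q e j. \<delta> * of_bool (q \<le> m) * drain \<kappa> m j
        + (\<kappa> - \<delta> - \<nu>) * of_bool (e = m) * drain \<kappa> q j)
    = \<delta> * expect (\<lambda>_. 0) (\<lambda>q e j. of_bool (q \<le> m) * drain \<kappa> m j) + \<delta> * y ^ m * (1 - lam)
      - (\<kappa> * prob_idle_lower + (\<delta> + \<nu> - \<kappa>) * drain_lower \<kappa>)"
    unfolding drain_lower_def prob_idle_lower_def expect_idle[symmetric] expect_linear
    by (rule expect_cong) (auto simp: algebra_simps)
  finally show ?thesis by simp
qed

text \<open>Discounting at rate \<open>\<delta> + \<nu>\<close> cancels \<open>drain_lower\<close> in the balance equation.\<close>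

lemma prob_idle_lower_pos: "0 < prob_idle_lower"
proof -
  have \<kappa>: "0 < \<delta> + \<nu>" using delta_pos nu_nonneg by simp
  have "0 < \<delta> * ph_laplace \<alpha> S (\<delta> + \<nu>) ^ m * (1 - lam)"
    using delta_pos lam_less_1 ph_laplace_pos[OF phase_type \<kappa>] by simp
  also have "\<dots> \<le> (\<delta> + \<nu>) * prob_idle_lower"
  proof -
    have "0 \<le> expect (\<lambda>_. 0) (\<lambda>q e j. of_bool (q \<le> m) * drain (\<delta> + \<nu>) m j)"
      using drain_bounds[OF \<kappa>] by (intro expect_nonneg) auto
    then show ?thesis
      using drain_lower_balance[OF \<kappa>] delta_pos
      by simp (smt (verit) mult_nonneg_nonneg)
  qed
  finally show ?thesis using \<kappa> by (simp add: zero_less_mult_iff)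
qed

lemma prob_idle_lower_le: "prob_idle_lower \<le> drain_lower \<delta>"
  unfolding prob_idle_lower_def drain_lower_def
  using drain_bounds[OF delta_pos] by (intro expect_mono) auto

lemma drain_lower_le: "drain_lower \<delta> \<le> 1 - prob_upper"
proof -
  have "drain_lower \<delta> \<le> expect (\<lambda>_. 1) (\<lambda>_ _ _. 1) - prob_upper"
    unfolding prob_upper_def drain_lower_def expect_linear
    using drain_bounds[OF delta_pos] by (intro expect_mono) auto
  then show ?thesis by (simp add: expect_const)
qed

section \<open>Exact formulas for the distance of the load from its two neighbours\<close>

definition laplace_full :: real where
  "laplace_full = expect (\<lambda>_. 0) (\<lambda>q _ j. of_bool (q = m + 1) * residual_laplace S \<delta> $ j)"

lemma laplace_full_bounds: "0 \<le> laplace_full" "laplace_full \<le> prob_full"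
  unfolding laplace_full_def prob_full_def
  using residual_laplace_pos[OF subgenerator invertible delta_pos]
    residual_laplace_less_1[OF subgenerator delta_pos]
  by (auto intro!: expect_nonneg expect_mono simp: less_imp_le)

text \<open>The finitely many residual transforms have a positive minimum.\<close>

lemma laplace_full_eq_0D: "laplace_full = 0 \<Longrightarrow> prob_full = 0"
proof -
  assume 0: "laplace_full = 0"
  obtain k where k: "\<And>j. residual_laplace S \<delta> $ k \<le> residual_laplace S \<delta> $ j"
    using ex_min_entry by blast
  have "residual_laplace S \<delta> $ k * prob_full \<le> laplace_full"
    unfolding laplace_full_def prob_full_def expect_mult
    using k by (intro expect_mono) auto
  moreover have "0 \<le> prob_full"
    unfolding prob_full_def by (intro expect_nonneg) auto
  ultimately show "prob_full = 0"
    using 0 residual_laplace_pos[OF subgenerator invertible delta_pos, of k]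
    by (simp add: mult_le_0_iff)
qed

text \<open>The left side is \<open>lam - lambda_at \<delta> y m\<close> times the denominator of
  \<open>lambda_at \<delta> y m\<close>. It follows by eliminating the expected drain between
  \<open>drain_balance\<close> and \<open>expect_residual_laplace\<close>.\<close>

lemma lower_gap:
  fixes y defines "y \<equiv> ph_laplace \<alpha> S \<delta>"
  shows "lam * y ^ m * (1 - y) - \<delta> * y * (1 - y ^ m) * (1 - lam)
    = (1 - y) * (\<delta> * y ^ m * laplace_full + \<nu> * y * drain_lower \<delta>)"
proof -
  \<comment> \<open>The factor \<open>y\<close> turns \<open>y ^ (m - 1)\<close> into
    \<open>y ^ m\<close>, so \<open>m = 0\<close> fits the same formula. States with
    \<open>q = m + 1\<close> carry one more factor \<open>y\<close>, hence the correction by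
    \<open>laplace_full\<close>.\<close>
  have "y * expect (\<lambda>_. 0) (\<lambda>q e j. drain \<delta> (max q m) j)
      = y ^ m * (expect (\<lambda>_. 0) (\<lambda>_ _ j. residual_laplace S \<delta> $ j) - (1 - y) * laplace_full)"
    unfolding laplace_full_def expect_linear
  proof (rule expect_cong)
    fix q e :: nat and j :: 'n assume q: "e = m \<or> e = m + 1" "1 \<le> q" "q \<le> e"
    show "y * drain \<delta> (max q m) j = y ^ m *
        (residual_laplace S \<delta> $ j - (1 - y) * (of_bool (q = m + 1) * residual_laplace S \<delta> $ j))"
    proof (cases "q = m + 1")
      case False
      then have "max q m = m" "1 \<le> m" using q by auto
      then show ?thesis
        using False by (cases m) (auto simp: drain_def y_def)
    qed (simp add: drain_def y_def algebra_simps)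
  qed simp
  from arg_cong[OF this, of "(*) \<delta>"] show ?thesis
    using arg_cong[OF drain_balance, of "(*) y"] arg_cong[OF expect_residual_laplace, of "(*) (y ^ m)"]
    unfolding y_def[symmetric] by (simp add: algebra_simps)
qed

text \<open>Times \<open>y\<close>, the left side is
  \<open>lambda_at \<delta> y (Suc m) - lam\<close> times the denominator of
  \<open>lambda_at \<delta> y (Suc m)\<close>.\<close>

lemma upper_gap:
  fixes y defines "y \<equiv> ph_laplace \<alpha> S \<delta>"
  shows "\<delta> * (1 - y ^ Suc m) * (1 - lam) - lam * y ^ m * (1 - y) = \<delta> * (1 - y) * prob_idle_lower"
proof -
  have y: "0 < y" unfolding y_def by (rule laplace_bounds)
  have "y * expect (\<lambda>_. 0) (\<lambda>q e j. of_bool (q \<le> m) * drain \<delta> m j)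
      = y ^ m * (expect (\<lambda>_. 0) (\<lambda>_ _ j. residual_laplace S \<delta> $ j) - laplace_full)"
    unfolding laplace_full_def expect_linear
  proof (rule expect_cong)
    fix q e :: nat and j :: 'n assume q: "e = m \<or> e = m + 1" "1 \<le> q" "q \<le> e"
    show "y * (of_bool (q \<le> m) * drain \<delta> m j) = y ^ m *
        (residual_laplace S \<delta> $ j - of_bool (q = m + 1) * residual_laplace S \<delta> $ j)"
      using q by (cases m; cases "q = m + 1") (auto simp: drain_def y_def)
  qed simp
  from arg_cong[OF this, of "(*) \<delta>"]
  have "lam * y ^ m * (1 - y) - \<delta> * y ^ m * laplace_full + \<delta> * y * y ^ m * (1 - lam)
      = \<delta> * y * prob_idle_lower + \<nu> * y * drain_lower \<delta>"
    using arg_cong[OF drain_lower_balance[OF delta_pos], of "(*) y"] arg_cong[OF expect_residual_laplace, of "(*) (y ^ m)"]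
    unfolding y_def[symmetric] by (simp add: algebra_simps)
  \<comment> \<open>The factor \<open>1 - y\<close> matches the coefficients in
    \<open>lower_gap\<close>, so \<open>laplace_full\<close> and \<open>drain_lower\<close> are
    eliminated together.\<close>
  from arg_cong[OF this, of "(*) (1 - y)"] lower_gap[folded y_def]
  have "y * (\<delta> * (1 - y ^ Suc m) * (1 - lam) - lam * y ^ m * (1 - y))
      = y * (\<delta> * (1 - y) * prob_idle_lower)"
    by (simp add: algebra_simps)
  then show ?thesis using y by simp
qed

section \<open>Bounds on the mean queue length in terms of \<open>m\<close>\<close>

lemma lambda_at_denominator:
  fixes y defines "y \<equiv> ph_laplace \<alpha> S \<delta>"
  shows "(1 - y) * y \<le> \<delta> * y * (1 - y ^ k) + y ^ k * (1 - y)"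
    and "(1 - y) * y ^ k \<le> \<delta> * y * (1 - y ^ k) + y ^ k * (1 - y)"
    and "0 < \<delta> * y * (1 - y ^ k) + y ^ k * (1 - y)"
proof -
  have y: "0 < y" "y < 1" and "1 - y \<le> \<delta>"
    using laplace_bounds ph_laplace_ge[OF phase_type delta_pos] mean_1
    by (auto simp: y_def)
  have "0 \<le> 1 - y ^ k"
    using y by (simp add: power_le_one)
  \<comment> \<open>The mean job size enters here through \<open>1 - y \<le> \<delta>\<close>; with
    \<open>y * y ^ k \<le> y ^ k\<close> the powers of \<open>y\<close> combine to
    \<open>(1 - y) * y\<close>.\<close>
  then have "(1 - y) * (y * (1 - y ^ k)) \<le> \<delta> * (y * (1 - y ^ k))"
    using y \<open>1 - y \<le> \<delta>\<close> by (intro mult_right_mono) auto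
  moreover have "y * y ^ k \<le> y ^ k" using y by simp
  then have "(1 - y) * (y * y ^ k) \<le> (1 - y) * y ^ k"
    using y by (intro mult_left_mono) auto
  ultimately show "(1 - y) * y \<le> \<delta> * y * (1 - y ^ k) + y ^ k * (1 - y)"
    by (simp add: algebra_simps)
  moreover have "0 < (1 - y) * y" using y by simp
  ultimately show "0 < \<delta> * y * (1 - y ^ k) + y ^ k * (1 - y)" by linarith
  show "(1 - y) * y ^ k \<le> \<delta> * y * (1 - y ^ k) + y ^ k * (1 - y)"
    using \<open>0 \<le> 1 - y ^ k\<close> y delta_pos by (simp add: mult.commute)
qed

text \<open>By the formula for the mean, the claim is
  \<open>lam - lambda_at \<delta> y m \<le> \<delta> * prob_upper\<close>.\<close>

lemma lower_bound:
  fixes y defines "y \<equiv> ph_laplace \<alpha> S \<delta>"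
  shows "real m - lambda_at \<delta> y m / \<delta> \<le> mean_queue_length m \<pi>"
proof -
  define Q where "Q = \<delta> * y * (1 - y ^ m) + y ^ m * (1 - y)"
  have Q: "(1 - y) * y \<le> Q" "(1 - y) * y ^ m \<le> Q" "0 < Q"
    using lambda_at_denominator[of m] by (auto simp: Q_def y_def)
  have "(lam - lambda_at \<delta> y m) * Q = lam * Q - \<delta> * y * (1 - y ^ m)"
    using Q(3) by (simp add: lambda_at_def left_diff_distrib flip: Q_def)
  also have "\<dots> = \<delta> * (((1 - y) * y ^ m) * laplace_full) + \<nu> * (((1 - y) * y) * drain_lower \<delta>)"
    using lower_gap by (simp add: Q_def y_def[symmetric] algebra_simps)
  also have "\<dots> \<le> \<delta> * (Q * prob_full) + \<nu> * (Q * (1 - prob_upper))"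
    using Q laplace_full_bounds drain_lower_le prob_idle_lower_le prob_idle_lower_pos
      delta_pos nu_nonneg
    by (intro add_mono mult_left_mono mult_mono) auto
  \<comment> \<open>The bound just reached is exactly the combination of \<open>prob_full\<close>
    and \<open>1 - prob_upper\<close> in \<open>estimate_balance\<close>.\<close>
  also have "\<dots> = (\<delta> * prob_upper) * Q"
    using arg_cong[OF estimate_balance, of "(*) Q"] by (simp add: algebra_simps)
  finally have "lam - lambda_at \<delta> y m \<le> \<delta> * prob_upper"
    using Q(3) by simp
  then have "(lam - lambda_at \<delta> y m) / \<delta> \<le> prob_upper"
    using delta_pos by (simp add: pos_divide_le_eq mult.commute)
  then show ?thesis
    by (simp add: mean_queue_length diff_divide_distrib)
qed

text \<open>Here the claim is \<open>lambda_at \<delta> y (Suc m) - lam \<le> \<delta> * (1 -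
  prob_upper)\<close>; an idle queue with estimate \<open>m\<close> is a special case of estimate
  \<open>m\<close>.\<close>

lemma upper_bound:
  fixes y defines "y \<equiv> ph_laplace \<alpha> S \<delta>"
  shows "mean_queue_length m \<pi> \<le> real (Suc m) - lambda_at \<delta> y (Suc m) / \<delta>"
proof -
  define Q where "Q = \<delta> * y * (1 - y ^ Suc m) + y ^ Suc m * (1 - y)"
  have Q: "(1 - y) * y \<le> Q" "0 < Q"
    using lambda_at_denominator[of "Suc m"] by (auto simp: Q_def y_def)
  have "(lambda_at \<delta> y (Suc m) - lam) * Q = \<delta> * y * (1 - y ^ Suc m) - lam * Q"
    using Q(2) unfolding lambda_at_def Q_def[symmetric] by (simp add: left_diff_distrib)
  also have "\<dots> = y * (\<delta> * (1 - y ^ Suc m) * (1 - lam) - lam * y ^ m * (1 - y))"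
    by (simp add: Q_def algebra_simps)
  also have "\<dots> = \<delta> * (((1 - y) * y) * prob_idle_lower)"
    using upper_gap by (simp add: y_def[symmetric])
  also have "\<dots> \<le> \<delta> * (Q * (1 - prob_upper))"
    using Q drain_lower_le prob_idle_lower_le prob_idle_lower_pos delta_pos
    by (intro mult_left_mono mult_mono) auto
  also have "\<dots> = (\<delta> * (1 - prob_upper)) * Q" by simp
  finally have "lambda_at \<delta> y (Suc m) - lam \<le> \<delta> * (1 - prob_upper)"
    using Q(2) by (simp only: mult_le_cancel_right_pos)
  then have "(lambda_at \<delta> y (Suc m) - lam) / \<delta> \<le> 1 - prob_upper"
    using delta_pos by (simp add: pos_divide_le_eq mult.commute)
  then show ?thesis
    by (simp add: mean_queue_length diff_divide_distrib)
qed

text \<open>The case of integral \<open>m_tilde\<close>: both nonnegative terms of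
  \<open>lower_gap\<close> vanish, and \<open>drain_lower \<delta>\<close> is positive, so
  \<open>\<nu> = 0\<close> and the queue is never full.\<close>

lemma prob_upper_eq_0:
  fixes y defines "y \<equiv> ph_laplace \<alpha> S \<delta>"
  assumes "lam * y ^ m * (1 - y) = \<delta> * y * (1 - y ^ m) * (1 - lam)"
  shows "prob_upper = 0"
proof -
  have y: "0 < y" "y < 1"
    unfolding y_def by (rule laplace_bounds)+
  have "\<delta> * y ^ m * laplace_full + \<nu> * y * drain_lower \<delta> = 0"
    using lower_gap assms(2) y by (simp add: y_def[symmetric])
  moreover have "0 \<le> \<delta> * y ^ m * laplace_full" "0 \<le> \<nu> * y * drain_lower \<delta>"
    using delta_pos nu_nonneg laplace_full_bounds prob_idle_lower_le prob_idle_lower_pos y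
    by auto
  ultimately have "\<delta> * y ^ m * laplace_full = 0" "\<nu> * y * drain_lower \<delta> = 0"
    by linarith+
  then have "prob_full = 0" "\<nu> = 0"
    using delta_pos y prob_idle_lower_le prob_idle_lower_pos laplace_full_eq_0D by auto
  then show ?thesis
    using estimate_balance delta_pos by simp
qed

section \<open>Locating \<open>m_tilde\<close> between consecutive integers\<close>

lemma m_tilde_iff:
  fixes y defines "y \<equiv> ph_laplace \<alpha> S \<delta>"
  shows "real k \<le> m_tilde \<delta> lam y \<longleftrightarrow> \<delta> * y * (1 - y ^ k) * (1 - lam) \<le> lam * y ^ k * (1 - y)"
    and "m_tilde \<delta> lam y \<le> real k \<longleftrightarrow> lam * y ^ k * (1 - y) \<le> \<delta> * y * (1 - y ^ k) * (1 - lam)"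
proof -
  have y: "0 < y" "y < 1"
    unfolding y_def by (rule laplace_bounds)+
  \<comment> \<open>\<open>R\<close> is the argument of the outer logarithm; since
    \<open>ln (1 / y)\<close> is positive, comparing \<open>m_tilde\<close> with \<open>k\<close>
    means comparing \<open>R\<close> with \<open>1 / y ^ k\<close>.\<close>
  define R where "R = 1 / y + (lam / (\<delta> * (1 - lam)) - 1) * ((1 - y) / y)"
  have R_eq: "R = 1 + lam * (1 - y) / (\<delta> * (1 - lam) * y)"
    using y delta_pos lam_less_1 by (simp add: R_def field_simps)
  have "0 < R"
    using y delta_pos lam_nonneg lam_less_1 unfolding R_eq by (intro add_pos_nonneg) auto
  have L: "0 < ln (1 / y)" using y by simp
  have lnk: "real k * ln (1 / y) = ln (1 / y ^ k)"
    using y by (simp add: ln_div ln_realpow)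
  \<comment> \<open>\<open>K\<close> clears the denominators of \<open>R\<close> and
    \<open>1 / y ^ k\<close>, giving the expression of \<open>lower_gap\<close> with
    \<open>k\<close> for \<open>m\<close>.\<close>
  define K where "K = \<delta> * (1 - lam) * y * y ^ k"
  have pos: "0 < K"
    using y delta_pos lam_less_1 by (simp add: K_def)
  have gap: "(R - 1 / y ^ k) * K
      = lam * y ^ k * (1 - y) - \<delta> * y * (1 - y ^ k) * (1 - lam)"
    unfolding R_eq K_def using y delta_pos lam_less_1 by (simp add: field_simps)
  have "real k \<le> m_tilde \<delta> lam y \<longleftrightarrow> ln (1 / y ^ k) \<le> ln R"
    using L unfolding m_tilde_def R_def[symmetric] lnk[symmetric] by (rule pos_le_divide_eq)
  also have "\<dots> \<longleftrightarrow> 0 \<le> R - 1 / y ^ k"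
    using \<open>0 < R\<close> y by simp
  also have "\<dots> \<longleftrightarrow> 0 \<le> (R - 1 / y ^ k) * K"
    using pos by (simp add: zero_le_mult_iff)
  finally show "real k \<le> m_tilde \<delta> lam y \<longleftrightarrow> \<delta> * y * (1 - y ^ k) * (1 - lam) \<le> lam * y ^ k * (1 - y)"
    unfolding gap by simp
  have "m_tilde \<delta> lam y \<le> real k \<longleftrightarrow> ln R \<le> ln (1 / y ^ k)"
    using L unfolding m_tilde_def R_def[symmetric] lnk[symmetric] by (rule pos_divide_le_eq)
  also have "\<dots> \<longleftrightarrow> R - 1 / y ^ k \<le> 0"
    using \<open>0 < R\<close> y by simp
  also have "\<dots> \<longleftrightarrow> (R - 1 / y ^ k) * K \<le> 0"
    using pos by (simp add: mult_le_0_iff)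
  finally show "m_tilde \<delta> lam y \<le> real k \<longleftrightarrow> lam * y ^ k * (1 - y) \<le> \<delta> * y * (1 - y ^ k) * (1 - lam)"
    unfolding gap by simp
qed

theorem mean_queue_length_bounds:
  fixes y mt defines "y \<equiv> ph_laplace \<alpha> S \<delta>" and "mt \<equiv> m_tilde \<delta> lam y"
  shows "of_int \<lfloor>mt\<rfloor> - lambda_at \<delta> y (nat \<lfloor>mt\<rfloor>) / \<delta> \<le> mean_queue_length m \<pi>"
    and "mean_queue_length m \<pi> \<le> of_int \<lceil>mt\<rceil> - lambda_at \<delta> y (nat \<lceil>mt\<rceil>) / \<delta>"
proof -
  have y: "0 < y" "y < 1"
    unfolding y_def by (rule laplace_bounds)+
  have "0 \<le> (1 - y) * (\<delta> * y ^ m * laplace_full + \<nu> * y * drain_lower \<delta>)"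
    using y delta_pos nu_nonneg laplace_full_bounds prob_idle_lower_le prob_idle_lower_pos by auto
  then have ge: "real m \<le> mt"
    using lower_gap unfolding mt_def y_def m_tilde_iff by simp
  \<comment> \<open>Strict positivity of \<open>prob_idle_lower\<close> excludes
    \<open>mt = m + 1\<close>, so the floor is exactly \<open>m\<close>.\<close>
  have "0 < y * (\<delta> * (1 - y) * prob_idle_lower)"
    using y delta_pos prob_idle_lower_pos by simp
  then have "0 < y * (\<delta> * (1 - y ^ Suc m) * (1 - lam) - lam * y ^ m * (1 - y))"
    using upper_gap by (simp add: y_def)
  then have "lam * y ^ Suc m * (1 - y) < \<delta> * y * (1 - y ^ Suc m) * (1 - lam)"
    by (simp add: algebra_simps)
  then have "mt < real (Suc m)"
    unfolding mt_def using m_tilde_iff(1)[of "Suc m"] unfolding y_def by linarith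
  with ge have "\<lfloor>mt\<rfloor> = int m" by linarith
  then show "of_int \<lfloor>mt\<rfloor> - lambda_at \<delta> y (nat \<lfloor>mt\<rfloor>) / \<delta> \<le> mean_queue_length m \<pi>"
    using lower_bound by (simp add: y_def)
  show "mean_queue_length m \<pi> \<le> of_int \<lceil>mt\<rceil> - lambda_at \<delta> y (nat \<lceil>mt\<rceil>) / \<delta>"
  \<comment> \<open>For integral \<open>mt\<close> the ceiling is \<open>m\<close>, so
    \<open>upper_bound\<close> does not give the claim; instead
    \<open>lambda_at \<delta> y m = lam\<close> and \<open>prob_upper = 0\<close> yield
    equality.\<close>
  proof (cases "mt = real m")
    case True
    then have eq: "lam * y ^ m * (1 - y) = \<delta> * y * (1 - y ^ m) * (1 - lam)"
      using m_tilde_iff[of m] unfolding mt_def y_def by linarith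
    define Q where "Q = \<delta> * y * (1 - y ^ m) + y ^ m * (1 - y)"
    have "0 < Q" using lambda_at_denominator(3)[of m] by (simp add: Q_def y_def)
    moreover have "lam * Q = \<delta> * y * (1 - y ^ m)"
      using eq by (simp add: Q_def algebra_simps)
    ultimately have "lambda_at \<delta> y m = lam"
      by (simp add: lambda_at_def nonzero_divide_eq_eq flip: Q_def)
    moreover have "prob_upper = 0"
      using eq prob_upper_eq_0 by (simp add: y_def)
    ultimately show ?thesis using True by (simp add: mean_queue_length)
  next
    case False
    then have "\<lceil>mt\<rceil> = int (Suc m)" using ge \<open>mt < real (Suc m)\<close> by linarith
    moreover from this have "nat \<lceil>mt\<rceil> = Suc m" by simp
    ultimately show ?thesis using upper_bound by (simp add: y_def)
  qed
qed

end

theorem theorem4p9: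
  fixes \<alpha> :: "real ^ 'n" and S :: "real ^ 'n ^ 'n"
    and \<delta> lam \<nu> y mt :: real and m :: nat and \<pi> :: "'n push_state \<Rightarrow> real"
  assumes "0 \<le> lam" and "lam < 1" and "0 < \<delta>"
    and "phase_type \<alpha> S" and "ph_mean \<alpha> S = 1"
    and "cavity_queue \<alpha> S \<delta> lam m \<nu> \<pi>"
  defines "y \<equiv> ph_laplace \<alpha> S \<delta>"
  defines "mt \<equiv> m_tilde \<delta> lam y"
  shows "of_int \<lfloor>mt\<rfloor> - lambda_at \<delta> y (nat \<lfloor>mt\<rfloor>) / \<delta> \<le> mean_queue_length m \<pi>
    \<and> mean_queue_length m \<pi> \<le> of_int \<lceil>mt\<rceil> - lambda_at \<delta> y (nat \<lceil>mt\<rceil>) / \<delta>"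
proof -
  interpret cavity \<alpha> S \<delta> lam \<nu> m \<pi>
    using assms(1-6) by unfold_locales
  show ?thesis
    using mean_queue_length_bounds by (simp add: y_def mt_def)
qed

end
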